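(* Let $f\in C_B[0,\infty)$ and $r\in(0,1]$. Then for every $n\in\mathbb{N}$, every $\alpha\in[0,\frac1n]$ and every $x\in[0,\infty)$, $$\left|\mathcal{U}_{n}^{[\alpha]}(f;x)-f(x)\right|\leq \kappa_r(f,x)\left(\Theta_{n,2}^{[\alpha]}(x)\right)^{\frac r2}.$$
   Context: For $n\in\mathbb{N}$, $0\le\alpha\le\frac1n$, $x\ge 0$ and a function $f$ on $[0,\infty)$ for which the expression converges absolutely, define $$\mathcal{U}_{n}^{[\alpha]}(f;x)=n\sum_{i=0}^{\infty}(1+n\alpha)^{-x/\alpha}\Big(\alpha+\frac1n\Big)^{-i}\frac{x^{(i,-\alpha)}}{i!}\int_0^\infty e^{-nu}\frac{(nu)^i}{i!}f(u)\,du,$$ with $x^{(0,-\alpha)}=1$ and $x^{(i,-\alpha)}=x(x+\alpha)\cdots(x+(i-1)\alpha)$; for $\alpha=0$ the coefficient is understood as its limit as $\alpha\to0$, namely $e^{-nx}\frac{(nx)^i}{i!}$. $\Theta_{n,2}^{[\alpha]}(x)=\mathcal{U}_{n}^{[\alpha]}((t-x)^2;x)$, the operator acting on the variable $t$. $C_B[0,\infty)$ is the space of continuous bounded functions on $[0,\infty)$. The Lipschitz maximal function of order $r\in(0,1]$ is $$\kappa_r(f,x)=\sup_{s\ge0,\ s\ne x}\frac{|f(s)-f(x)|}{|s-x|^r}\in[0,\infty].$$ *)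

theory Defs
  imports "HOL-Analysis.Analysis"
begin

text \<open>
  Functions on \<open>[0,\<infinity>)\<close> are represented by functions of type \<open>real \<Rightarrow> real\<close>;
  every definition below inspects them on \<open>{0..}\<close> only.
\<close>

definition CB :: "(real \<Rightarrow> real) set" where
  "CB = {f. continuous_on {0..} f \<and> bounded (f ` {0..})}"

definition rising :: "real \<Rightarrow> real \<Rightarrow> nat \<Rightarrow> real" where
  "rising \<alpha> x i = (\<Prod>j<i. x + real j * \<alpha>)"

text \<open>
  The branch \<open>\<alpha> = 0\<close> is the limit of the other one as \<open>\<alpha>\<close> tends to \<open>0\<close> from the right.
\<close>

definition U_coeff :: "nat \<Rightarrow> real \<Rightarrow> real \<Rightarrow> nat \<Rightarrow> real" where
  "U_coeff n \<alpha> x i =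
     (if \<alpha> = 0 then exp (- (real n * x)) * (real n * x) ^ i / fact i
      else (1 + real n * \<alpha>) powr (- x / \<alpha>) * (\<alpha> + 1 / real n) powi (- int i)
             * (rising \<alpha> x i / fact i))"

text \<open>
  This is the intended operator only where the integrals and the series converge absolutely;
  elsewhere its value carries no meaning.
\<close>

definition U :: "nat \<Rightarrow> real \<Rightarrow> (real \<Rightarrow> real) \<Rightarrow> real \<Rightarrow> real" where
  "U n \<alpha> f x =
     real n * (\<Sum>i. U_coeff n \<alpha> x i *
       (LBINT u:{0..}. exp (- (real n * u)) * ((real n * u) ^ i / fact i) * f u))"

definition Theta2 :: "nat \<Rightarrow> real \<Rightarrow> real \<Rightarrow> real" where
  "Theta2 n \<alpha> x = U n \<alpha> (\<lambda>t. (t - x)\<^sup>2) x"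

definition lip_max :: "real \<Rightarrow> (real \<Rightarrow> real) \<Rightarrow> real \<Rightarrow> ennreal" where
  "lip_max r f x = (SUP s\<in>{0..} - {x}. ennreal (\<bar>f s - f x\<bar> / \<bar>s - x\<bar> powr r))"

end

theory Submission
  imports Defs "HOL-Probability.Distributions" "HOL-Real_Asymp.Real_Asymp"
begin

text \<open>
  The operator averages \<open>f\<close> against a probability distribution, a mixture of Erlang laws with
  Poisson weights (\<open>\<alpha> = 0\<close>) or negative binomial weights (\<open>\<alpha> > 0\<close>). Hoelder's
  inequality for this distribution is replaced by Young's inequality
  \<open>\<bar>t - x\<bar>\<^sup>r \<le> (1 - r/2) \<Theta> powr (r/2) + (r/2) \<Theta> powr (r/2 - 1) (t - x)\<^sup>2\<close>, whose two terms
  integrate to \<open>\<Theta> powr (r/2)\<close>. The second moment \<open>\<Theta>\<close> is positive, so the bound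
  is \<open>\<infinity>\<close> if the Lipschitz constant is.
\<close>

section \<open>Moments and mean deviations of the Erlang laws\<close>

lemma erlang_moment:
  assumes "0 < l"
  shows "has_bochner_integral lborel (\<lambda>u. erlang_density k l u * u ^ j)
           (fact (k + j) / (fact k * l ^ j))"
proof (rule has_bochner_integral_nn_integral)
  show "AE u in lborel. 0 \<le> erlang_density k l u * u ^ j"
    using assms by (intro AE_I2) (auto simp: erlang_density_def)
  show "(\<integral>\<^sup>+ u. ennreal (erlang_density k l u * u ^ j) \<partial>lborel) = ennreal (fact (k + j) / (fact k * l ^ j))"
    using nn_integral_erlang_ith_moment[OF assms, of k j] by simp
qed (use assms in auto)

text \<open>Mean squared deviation from \<open>x\<close>, as squared bias plus variance.\<close>

definition erlang_msd :: "real \<Rightarrow> real \<Rightarrow> nat \<Rightarrow> real" where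
  "erlang_msd l x i = ((real i + 1) / l - x)\<^sup>2 + (real i + 1) / l\<^sup>2"

lemma erlang_msd_pos: "0 < l \<Longrightarrow> 0 < erlang_msd l x i"
  unfolding erlang_msd_def by (intro add_nonneg_pos) auto

lemma erlang_msd_le:
  assumes "0 < l" "0 \<le> x"
  shows "erlang_msd l x i \<le> (1 / l\<^sup>2 + x\<^sup>2) * ((real i + 1) * (real i + 2))"
proof -
  have "erlang_msd l x i
      = (real i + 1) * (real i + 2) / l\<^sup>2 - 2 * x * (real i + 1) / l + x\<^sup>2 * 1"
    using assms by (simp add: erlang_msd_def power2_eq_square field_simps)
  also have "\<dots> \<le> (real i + 1) * (real i + 2) / l\<^sup>2 - 0 + x\<^sup>2 * ((real i + 1) * (real i + 2))"
    using assms by (intro add_mono diff_mono mult_left_mono) (auto simp: algebra_simps)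
  finally show ?thesis by (simp add: algebra_simps add_divide_distrib)
qed

text \<open>The square is expanded into the moments of order 0, 1 and 2. With b = 0 this also says
  that the density has mass one.\<close>

lemma has_bochner_integral_erlang_msd:
  assumes "0 < l"
  shows "has_bochner_integral lborel (\<lambda>u. erlang_density i l u * (a + b * (u - x)\<^sup>2))
           (a + b * erlang_msd l x i)"
proof -
  let ?m = "\<lambda>j. fact (i + j) / (fact i * l ^ j)"
  have "has_bochner_integral lborel
      (\<lambda>u. (a + b * x\<^sup>2) * (erlang_density i l u * u ^ 0) + (- 2 * b * x) * (erlang_density i l u * u ^ 1)
         + b * (erlang_density i l u * u ^ 2))
      ((a + b * x\<^sup>2) * ?m 0 + (- 2 * b * x) * ?m 1 + b * ?m 2)"
    by (intro has_bochner_integral_add has_bochner_integral_mult_right erlang_moment assms)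
  moreover have "(a + b * x\<^sup>2) * ?m 0 + (- 2 * b * x) * ?m 1 + b * ?m 2 = a + b * erlang_msd l x i"
    using assms by (simp add: erlang_msd_def numeral_2_eq_2 field_simps)
  ultimately show ?thesis
    by (simp add: power2_eq_square algebra_simps)
qed

text \<open>As the density has mass one, \<open>f x\<close> moves under the integral. The quadratic
  majorant then gives both integrability and the bound.\<close>

lemma erlang_mean_deviation:
  assumes "0 < l" and "continuous_on {0..} f" and "0 \<le> a" "0 \<le> b"
    and bound: "\<And>u. 0 \<le> u \<Longrightarrow> \<bar>f u - f x\<bar> \<le> a + b * (u - x)\<^sup>2"
  shows "\<bar>(LINT u|lborel. erlang_density i l u * f u) - f x\<bar> \<le> a + b * erlang_msd l x i"
proof -
  let ?e = "erlang_density i l"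
  note major = has_bochner_integral_erlang_msd[OF \<open>0 < l\<close>, of i a b x]
  have one: "has_bochner_integral lborel (\<lambda>u. ?e u * f x) (f x)"
    using has_bochner_integral_erlang_msd[OF \<open>0 < l\<close>, of i "f x" 0 x] by simp
  \<comment> \<open>\<open>f\<close> is only known on \<open>{0..}\<close>, so measurability is
    shown for its cut-off; the density vanishes on negative arguments, so nothing changes under the
    integral.\<close>
  have [measurable]: "(\<lambda>u. indicator {0..} u *\<^sub>R f u) \<in> borel_measurable borel"
    using assms by (intro borel_measurable_continuous_on_indicator) auto
  have eq: "(\<lambda>u. ?e u * (f u - f x)) = (\<lambda>u. ?e u * (indicator {0..} u *\<^sub>R f u - f x))"
    by (auto simp: erlang_density_def fun_eq_iff)
  have dom: "norm (?e u * (f u - f x)) \<le> ?e u * (a + b * (u - x)\<^sup>2)" for u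
  proof (cases "u < 0")
    case False
    then show ?thesis
      using bound[of u] \<open>0 < l\<close> by (auto simp: abs_mult intro!: mult_left_mono)
  qed (simp add: erlang_density_def)
  have int: "integrable lborel (\<lambda>u. ?e u * (f u - f x))"
  proof (rule Bochner_Integration.integrable_bound)
    show "integrable lborel (\<lambda>u. ?e u * (a + b * (u - x)\<^sup>2))"
      using major by (rule integrable.intros)
    show "(\<lambda>u. ?e u * (f u - f x)) \<in> borel_measurable lborel"
      unfolding eq by measurable
    show "AE u in lborel. norm (?e u * (f u - f x)) \<le> norm (?e u * (a + b * (u - x)\<^sup>2))"
      using dom by (intro AE_I2) (smt (verit) real_norm_def)
  qed
  have "(LINT u|lborel. ?e u * f u) = (LINT u|lborel. ?e u * (f u - f x) + ?e u * f x)"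
    by (simp add: algebra_simps)
  also have "\<dots> = (LINT u|lborel. ?e u * (f u - f x)) + f x"
    using int one by (simp add: has_bochner_integral_iff)
  finally have "\<bar>(LINT u|lborel. ?e u * f u) - f x\<bar> = norm (LINT u|lborel. ?e u * (f u - f x))"
    by simp
  also have "\<dots> \<le> (LINT u|lborel. ?e u * (a + b * (u - x)\<^sup>2))"
    using major int dom
    by (intro Bochner_Integration.integral_norm_bound_integral) (auto simp: has_bochner_integral_iff)
  also have "\<dots> = a + b * erlang_msd l x i"
    using major by (simp add: has_bochner_integral_iff)
  finally show ?thesis .
qed

section \<open>The mixing weights: total mass and decay\<close>

lemma U_coeff_0:
  "U_coeff n \<alpha> x 0 =
     (if \<alpha> = 0 then exp (- (real n * x))
      else (1 + real n * \<alpha>) powr (- x / \<alpha>))"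
  by (simp add: U_coeff_def rising_def)

lemma U_coeff_nonneg: "0 \<le> \<alpha> \<Longrightarrow> 0 \<le> x \<Longrightarrow> 0 \<le> U_coeff n \<alpha> x i"
  by (auto simp: U_coeff_def rising_def intro!: mult_nonneg_nonneg divide_nonneg_nonneg prod_nonneg)

text \<open>One recursion covers both branches, as for \<alpha> = 0 the factor is the Poisson ratio
  n x / (i + 1). The ratio test can thus treat them together.\<close>

lemma U_coeff_Suc:
  assumes "0 \<le> \<alpha>" "n \<ge> 1"
  shows "U_coeff n \<alpha> x (Suc i)
    = U_coeff n \<alpha> x i * ((x + real i * \<alpha>) / ((\<alpha> + 1 / real n) * (real i + 1)))"
proof (cases "\<alpha> = 0")
  case True
  then show ?thesis using assms by (simp add: U_coeff_def field_simps)
next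
  case False
  have "\<alpha> + 1 / real n > 0" using assms by (intro add_nonneg_pos) auto
  moreover have "y powi (- int (Suc i)) = y powi (- int i) / y" for y :: real
    by (simp add: power_int_minus power_int_of_nat field_simps del: of_nat_Suc)
  ultimately show ?thesis using False
    by (simp add: U_coeff_def rising_def field_simps del: of_nat_Suc)
       (simp add: algebra_simps)
qed

text \<open>For \<alpha> = 0 this is the exponential series. Otherwise the weights are c times the
  terms of the binomial series of (1 - q) powr (-x/\<alpha>), where 1 - q = 1 / (1 + n \<alpha>), so
  that series has the value 1/c.\<close>

lemma U_coeff_sums_1:
  assumes "0 \<le> \<alpha>" "n \<ge> 1"
  shows "U_coeff n \<alpha> x sums 1"
proof (cases "\<alpha> = 0")
  case True
  have "(\<lambda>i. exp (- (real n * x)) * ((real n * x) ^ i / fact i)) sums (exp (- (real n * x)) * exp (real n * x))"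
    using exp_converges[of "real n * x"] by (intro sums_mult) (simp add: divide_inverse mult.commute)
  then show ?thesis
    using True by (simp add: U_coeff_def[abs_def] exp_minus)
next
  case False
  define q where "q = \<alpha> / (\<alpha> + 1 / real n)"
  define c where "c = (1 + real n * \<alpha>) powr (- x / \<alpha>)"
  have pos: "\<alpha> > 0" "real n > 0" "\<alpha> + 1 / real n > 0" "1 + real n * \<alpha> > 0"
    using assms False by (auto intro!: add_pos_pos)
  have "\<bar>- q\<bar> < 1" using pos by (simp add: q_def)
  have "1 + - q = inverse (1 + real n * \<alpha>)"
    using pos unfolding q_def by (simp add: field_simps)
  then have *: "(1 + - q) powr (- (x / \<alpha>)) = inverse c"
    using pos by (simp add: c_def powr_minus inverse_powr)
  have "(\<lambda>i. c * ((- (x / \<alpha>) gchoose i) * (- q) ^ i)) sums (c * inverse c)"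
    using gen_binomial_real[OF \<open>\<bar>- q\<bar> < 1\<close>, of "- (x / \<alpha>)"] unfolding * by (rule sums_mult)
  moreover have "c * ((- (x / \<alpha>) gchoose i) * (- q) ^ i) = U_coeff n \<alpha> x i" for i
  proof -
    \<comment> \<open>Pulling \<alpha> out of each factor leaves a Pochhammer symbol; the extracted
      power of \<alpha> joins the power of \<alpha> + 1/n to form \<open>q ^ i\<close>.\<close>
    have "rising \<alpha> x i = (\<Prod>j<i. \<alpha> * (x / \<alpha> + real j))"
      unfolding rising_def using pos by (intro prod.cong) (auto simp: field_simps)
    also have "\<dots> = \<alpha> ^ i * pochhammer (x / \<alpha>) i"
      by (simp add: prod.distrib pochhammer_prod atLeast0LessThan)
    finally have "U_coeff n \<alpha> x i = c * (q ^ i * (pochhammer (x / \<alpha>) i / fact i))"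
      using False by (simp add: U_coeff_def c_def q_def power_int_minus power_int_of_nat field_simps)
    moreover have "(- (x / \<alpha>) gchoose i) * (- q) ^ i = q ^ i * (pochhammer (x / \<alpha>) i / fact i)"
      by (simp add: gbinomial_pochhammer power_minus[of q])
    ultimately show ?thesis by simp
  qed
  moreover have "c * inverse c = 1" using pos by (simp add: c_def)
  ultimately show ?thesis by simp
qed

lemma summable_U_coeff_quadratic:
  assumes "0 \<le> \<alpha>" "n \<ge> 1" "0 \<le> x"
  shows "summable (\<lambda>i. U_coeff n \<alpha> x i * ((real i + 1) * (real i + 2)))"
proof -
  define \<beta> where "\<beta> = \<alpha> + 1 / real n"
  \<comment> \<open>The ratio of consecutive terms: the factor of \<open>U_coeff_Suc\<close> times
    (i + 3) / (i + 1). Its limit \<alpha> / \<beta> is below 1 because \<beta> - \<alpha> =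
    1/n.\<close>
  define \<rho> where "\<rho> i = (x + real i * \<alpha>) * (real i + 3) / (\<beta> * (real i + 1)\<^sup>2)" for i
  have \<beta>: "\<beta> > 0" "\<alpha> < \<beta>" using assms by (auto simp: \<beta>_def intro!: add_nonneg_pos)
  have "\<rho> \<longlonglongrightarrow> \<alpha> / \<beta>"
    unfolding \<rho>_def using \<beta> by real_asymp (simp add: divide_inverse)
  moreover obtain c where c: "\<alpha> / \<beta> < c" "c < 1"
    using \<beta> dense[of "\<alpha> / \<beta>" 1] by auto
  ultimately have "eventually (\<lambda>i. \<rho> i < c) sequentially"
    by (auto intro: order_tendstoD)
  then obtain N where N: "\<And>i. i \<ge> N \<Longrightarrow> \<rho> i < c"
    by (auto simp: eventually_sequentially)
  show ?thesis
  proof (rule summable_ratio_test[OF \<open>c < 1\<close>])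
    fix i assume "N \<le> i"
    let ?a = "\<lambda>i. U_coeff n \<alpha> x i * ((real i + 1) * (real i + 2))"
    have nonneg: "0 \<le> ?a i" for i
      using assms U_coeff_nonneg by simp
    have "?a (Suc i) = \<rho> i * ?a i"
      using \<beta> assms(1,2) unfolding U_coeff_Suc[OF assms(1,2)] \<rho>_def \<beta>_def[symmetric]
      by (simp add: divide_simps power2_eq_square) (simp add: algebra_simps)
    also have "\<dots> \<le> c * ?a i"
      using N[OF \<open>N \<le> i\<close>] nonneg by (intro mult_right_mono) auto
    finally show "norm (?a (Suc i)) \<le> c * norm (?a i)"
      using nonneg[of i] nonneg[of "Suc i"] by (simp only: real_norm_def abs_of_nonneg)
  qed
qed

lemma summable_U_coeff_msd:
  assumes "0 \<le> \<alpha>" "n \<ge> 1" "0 \<le> x"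
  shows "summable (\<lambda>i. U_coeff n \<alpha> x i * erlang_msd (real n) x i)"
proof (rule summable_comparison_test')
  show "summable (\<lambda>i. (1 / (real n)\<^sup>2 + x\<^sup>2) * (U_coeff n \<alpha> x i * ((real i + 1) * (real i + 2))))"
    using assms by (intro summable_mult summable_U_coeff_quadratic)
  fix i
  show "norm (U_coeff n \<alpha> x i * erlang_msd (real n) x i)
      \<le> (1 / (real n)\<^sup>2 + x\<^sup>2) * (U_coeff n \<alpha> x i * ((real i + 1) * (real i + 2)))"
    using mult_left_mono[OF erlang_msd_le[of "real n" x i] U_coeff_nonneg[of \<alpha> x n i]]
      erlang_msd_pos[of "real n" x i] U_coeff_nonneg[of \<alpha> x n i] assms
    by (simp add: abs_mult algebra_simps)
qed

section \<open>The operator as a mixture of Erlang means\<close>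

lemma U_eq_suminf:
  assumes "n \<ge> 1"
    and "summable (\<lambda>i. U_coeff n \<alpha> x i * (LINT u|lborel. erlang_density i (real n) u * f u))"
  shows "U n \<alpha> f x = (\<Sum>i. U_coeff n \<alpha> x i * (LINT u|lborel. erlang_density i (real n) u * f u))"
proof -
  let ?I = "\<lambda>i. LBINT u:{0..}. exp (- (real n * u)) * ((real n * u) ^ i / fact i) * f u"
  \<comment> \<open>The factor n in front of the series is what normalises each kernel to an Erlang
    density.\<close>
  have eq: "(LINT u|lborel. erlang_density i (real n) u * f u) = real n * ?I i" for i
    unfolding set_lebesgue_integral_def integral_mult_right_zero[symmetric]
    by (intro Bochner_Integration.integral_cong)
       (auto simp: erlang_density_def indicator_def power_mult_distrib)
  have "summable (\<lambda>i. real n * (U_coeff n \<alpha> x i * ?I i))"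
    using assms(2) unfolding eq by (simp add: mult_ac)
  then have "summable (\<lambda>i. U_coeff n \<alpha> x i * ?I i)"
    by (subst (asm) summable_cmult_iff) (use assms(1) in auto)
  from suminf_mult[OF this, of "real n"] show ?thesis
    unfolding U_def eq by (simp add: mult_ac)
qed

text \<open>Convergence is part of the claim: \<open>U\<close> is a \<open>suminf\<close>, whose
  value would otherwise carry no information.\<close>

lemma Theta2_sums:
  assumes "0 \<le> \<alpha>" "n \<ge> 1" "0 \<le> x"
  shows "(\<lambda>i. U_coeff n \<alpha> x i * erlang_msd (real n) x i) sums Theta2 n \<alpha> x"
proof -
  have eq: "(LINT u|lborel. erlang_density i (real n) u * (u - x)\<^sup>2) = erlang_msd (real n) x i" for i
    using has_bochner_integral_erlang_msd[of "real n" i 0 1 x] assms(2)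
    by (simp add: has_bochner_integral_iff)
  show ?thesis
    using U_eq_suminf[of n \<alpha> x "\<lambda>u. (u - x)\<^sup>2"] summable_U_coeff_msd[OF assms] assms(2)
    by (simp add: eq Theta2_def summable_sums)
qed

text \<open>The term i = 0 suffices: its weight is positive and its Erlang law has variance
  1/n^2.\<close>

lemma Theta2_pos:
  assumes "0 \<le> \<alpha>" "n \<ge> 1" "0 \<le> x"
  shows "0 < Theta2 n \<alpha> x"
proof -
  let ?a = "\<lambda>i. U_coeff n \<alpha> x i * erlang_msd (real n) x i"
  have "0 \<le> ?a i" for i
    using assms erlang_msd_pos[of "real n" x i] U_coeff_nonneg[of \<alpha> x n i] by simp
  moreover have "0 < ?a 0"
    using assms erlang_msd_pos[of "real n" x 0] by (simp add: U_coeff_0 add_nonneg_eq_0_iff)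
  ultimately have "0 < (\<Sum>i. ?a i)"
    using summable_U_coeff_msd[OF assms] by (intro suminf_pos2[where i = 0])
  then show ?thesis
    using Theta2_sums[OF assms] by (simp add: sums_iff)
qed

text \<open>Since the weights sum to 1, averaging \<open>erlang_mean_deviation\<close> over i
  carries a quadratic majorant from \<open>f\<close> to the operator.\<close>

lemma U_deviation:
  assumes "0 \<le> \<alpha>" "n \<ge> 1" "0 \<le> x"
    and "continuous_on {0..} f" and "0 \<le> a" "0 \<le> b"
    and bound: "\<And>u. 0 \<le> u \<Longrightarrow> \<bar>f u - f x\<bar> \<le> a + b * (u - x)\<^sup>2"
  shows "\<bar>U n \<alpha> f x - f x\<bar> \<le> a + b * Theta2 n \<alpha> x"
proof -
  define E where "E i = (LINT u|lborel. erlang_density i (real n) u * f u)" for i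
  let ?w = "U_coeff n \<alpha> x" and ?m = "erlang_msd (real n) x"
  have major: "(\<lambda>i. a * ?w i + b * (?w i * ?m i)) sums (a * 1 + b * Theta2 n \<alpha> x)"
    using assms by (intro sums_add sums_mult U_coeff_sums_1 Theta2_sums)
  have dom: "norm (?w i * (E i - f x)) \<le> a * ?w i + b * (?w i * ?m i)" for i
  proof -
    have "\<bar>E i - f x\<bar> \<le> a + b * ?m i"
      unfolding E_def using assms by (intro erlang_mean_deviation) auto
    from mult_left_mono[OF this U_coeff_nonneg[OF assms(1,3), of n i]] show ?thesis
      using U_coeff_nonneg[OF assms(1,3), of n i] by (simp add: abs_mult distrib_left mult_ac)
  qed
  have sumD: "summable (\<lambda>i. ?w i * (E i - f x))"
    by (rule summable_comparison_test'[OF sums_summable[OF major] dom])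
  \<comment> \<open>Summability of the series for \<open>U\<close> itself is recovered from the
    deviations plus the constant part; \<open>U_eq_suminf\<close> requires it.\<close>
  have "(\<lambda>i. ?w i * (E i - f x) + ?w i * f x) sums ((\<Sum>i. ?w i * (E i - f x)) + 1 * f x)"
    using assms by (intro sums_add summable_sums sumD sums_mult2 U_coeff_sums_1)
  moreover have "(\<lambda>i. ?w i * (E i - f x) + ?w i * f x) = (\<lambda>i. ?w i * E i)"
    by (simp add: algebra_simps)
  ultimately have sumE: "(\<lambda>i. ?w i * E i) sums ((\<Sum>i. ?w i * (E i - f x)) + f x)"
    by simp
  have "U n \<alpha> f x = (\<Sum>i. ?w i * E i)"
    using assms(2) sums_summable[OF sumE] unfolding E_def by (rule U_eq_suminf)
  then have "\<bar>U n \<alpha> f x - f x\<bar> = norm (\<Sum>i. ?w i * (E i - f x))"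
    using sums_unique[OF sumE] by simp
  also have "\<dots> \<le> (\<Sum>i. a * ?w i + b * (?w i * ?m i))"
    by (rule norm_suminf_le[OF dom sums_summable[OF major]])
  also have "\<dots> = a + b * Theta2 n \<alpha> x"
    using major by (simp add: sums_iff)
  finally show ?thesis .
qed

section \<open>The pointwise majorant and the conclusion\<close>

text \<open>The right side is the tangent at t = \<theta> of the concave function t powr (r/2),
  evaluated at \<open>d\<^sup>2\<close>. Weighted AM-GM gives it after division by \<theta> powr (1
  - r/2).\<close>

lemma powr_le_quadratic:
  fixes r \<theta> d :: real
  assumes "0 < r" "r \<le> 2" "0 < \<theta>"
  shows "\<bar>d\<bar> powr r \<le> (1 - r / 2) * \<theta> powr (r / 2) + r / 2 * \<theta> powr (r / 2 - 1) * d\<^sup>2"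
proof (cases "d = 0")
  case True
  then show ?thesis using assms by simp
next
  case False
  have "d\<^sup>2 = \<bar>d\<bar> powr 2"
    using False by simp
  then have "\<bar>d\<bar> powr r * \<theta> powr (1 - r / 2) = (d\<^sup>2) powr (r / 2) * \<theta> powr (1 - r / 2)"
    by (simp only: powr_powr) simp
  also have "\<dots> \<le> r / 2 * d\<^sup>2 + (1 - r / 2) * \<theta>"
    using assms False by (intro Youngs_inequality_0) auto
  finally have "\<bar>d\<bar> powr r * \<theta> powr (1 - r / 2) * \<theta> powr (r / 2 - 1)
      \<le> (r / 2 * d\<^sup>2 + (1 - r / 2) * \<theta>) * \<theta> powr (r / 2 - 1)"
    by (rule mult_right_mono) simp
  moreover have "\<theta> powr (1 - r / 2) * \<theta> powr (r / 2 - 1) = 1"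
    using assms by (simp flip: powr_add)
  moreover have "\<theta> * \<theta> powr (r / 2 - 1) = \<theta> powr (r / 2)"
    using assms by (simp add: powr_diff)
  moreover have "(r / 2 * d\<^sup>2 + (1 - r / 2) * \<theta>) * \<theta> powr (r / 2 - 1)
      = (1 - r / 2) * (\<theta> * \<theta> powr (r / 2 - 1)) + r / 2 * \<theta> powr (r / 2 - 1) * d\<^sup>2"
    by (simp add: algebra_simps)
  ultimately show ?thesis
    by (simp only: mult.assoc mult_1_right)
qed

text \<open>Finiteness matters because \<open>enn2real\<close> sends \<open>top\<close> to 0. The
  supremum skips s = x, where both sides vanish.\<close>

lemma lip_max_bound:
  assumes "lip_max r f x \<noteq> top" "0 \<le> s"
  shows "\<bar>f s - f x\<bar> \<le> enn2real (lip_max r f x) * \<bar>s - x\<bar> powr r"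
proof (cases "s = x")
  case False
  have "ennreal (\<bar>f s - f x\<bar> / \<bar>s - x\<bar> powr r) \<le> lip_max r f x"
    unfolding lip_max_def using assms False by (intro SUP_upper) auto
  then have "\<bar>f s - f x\<bar> / \<bar>s - x\<bar> powr r \<le> enn2real (lip_max r f x)"
    using assms(1) by (subst ennreal_le_iff[symmetric]) (auto simp: less_top)
  then show ?thesis using False by (simp add: field_simps)
qed simp

theorem theorem3p2:
  fixes f :: "real \<Rightarrow> real" and r \<alpha> x :: real and n :: nat
  assumes "f \<in> CB"
    and "0 < r" and "r \<le> 1"
    and "n \<ge> 1"
    and "0 \<le> \<alpha>" and "\<alpha> \<le> 1 / real n"
    and "0 \<le> x"
  shows "ennreal \<bar>U n \<alpha> f x - f x\<bar> \<le> lip_max r f x * ennreal (Theta2 n \<alpha> x powr (r / 2))"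
proof -
  define \<theta> where "\<theta> = Theta2 n \<alpha> x"
  have "0 < \<theta>" unfolding \<theta>_def using assms by (intro Theta2_pos)
  show ?thesis
  proof (cases "lip_max r f x = top")
    case True
    \<comment> \<open>In \<open>ennreal\<close>, \<open>top\<close> times 0 is 0, so positivity of
      \<theta> is what makes the right side infinite.\<close>
    then show ?thesis
      using \<open>0 < \<theta>\<close> by (simp add: ennreal_top_mult flip: \<theta>_def)
  next
    case False
    define K where "K = enn2real (lip_max r f x)"
    let ?a = "(1 - r / 2) * \<theta> powr (r / 2)" and ?b = "r / 2 * \<theta> powr (r / 2 - 1)"
    have "0 \<le> K" by (simp add: K_def)
    have "\<bar>U n \<alpha> f x - f x\<bar> \<le> K * ?a + K * ?b * \<theta>"
      unfolding \<theta>_def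
    proof (rule U_deviation; (unfold \<theta>_def[symmetric])?)
      fix u :: real assume "0 \<le> u"
      have "\<bar>f u - f x\<bar> \<le> K * \<bar>u - x\<bar> powr r"
        unfolding K_def using False \<open>0 \<le> u\<close> by (rule lip_max_bound)
      also have "\<dots> \<le> K * (?a + ?b * (u - x)\<^sup>2)"
        using assms \<open>0 < \<theta>\<close> \<open>0 \<le> K\<close> by (intro mult_left_mono powr_le_quadratic) auto
      finally show "\<bar>f u - f x\<bar> \<le> K * ?a + K * ?b * (u - x)\<^sup>2"
        by (simp add: algebra_simps)
    qed (use assms \<open>0 \<le> K\<close> in \<open>auto simp: CB_def\<close>)
    \<comment> \<open>Averaging replaces the square by its mean \<theta>, the point of tangency, so
      the tangent returns exactly \<theta> powr (r/2).\<close>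
    also have "K * ?a + K * ?b * \<theta> = K * \<theta> powr (r / 2)"
    proof -
      have "\<theta> powr (r / 2 - 1) * \<theta> = \<theta> powr (r / 2)"
        using \<open>0 < \<theta>\<close> by (simp add: powr_diff)
      then have "K * ?b * \<theta> = K * (r / 2) * \<theta> powr (r / 2)" by simp
      then show ?thesis by (simp add: algebra_simps)
    qed
    finally have "ennreal \<bar>U n \<alpha> f x - f x\<bar> \<le> ennreal K * ennreal (\<theta> powr (r / 2))"
      using \<open>0 \<le> K\<close> by (simp flip: ennreal_mult)
    then show ?thesis
      using False by (simp add: K_def \<theta>_def less_top)
  qed
qed

end
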